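(* Let ${\mathbf G}$ be a finite abelian group, $N=|{\mathbf G}|$, $r\geq2$, and $k_1,\dots,k_r\geq2$ even integers. Then $f\mapsto\|f\|_{E_{k_1,\dots,k_r}}$ is a norm on the space of functions $f:{\mathbf G}\to\mathbb{R}$. Further, if $t\geq r$ and $m_1,\dots,m_t\geq2$ are even integers with $k_j\leq m_j$ for all $j\in[r]$, then for every $f:{\mathbf G}\to\mathbb{R}$, $$\|f\|_{\bar{E}_{k_1,\dots,k_r}}\leq\|f\|_{\bar{E}_{m_1,\dots,m_t}}.$$
   Context: Let $K=\prod_jk_j$ and $B=[k_1]\times\dots\times[k_r]$. For $x_i=(x_i^{(1)},\dots,x_i^{(k_i)})\in{\mathbf G}^{k_i}$ define $\|f\|^K_{E_{k_1,\dots,k_r}}=\sum_{x_1\in{\mathbf G}^{k_1}}\cdots\sum_{x_r\in{\mathbf G}^{k_r}}\prod_{\omega\in B}f(x_1^{(\omega_1)}+\dots+x_r^{(\omega_r)})$ (nonnegative when $K$ is even), with $\|f\|_{E_{k_1,\dots,k_r}}$ its nonnegative $K$-th root, and the normalized version $\|f\|^K_{\bar{E}_{k_1,\dots,k_r}}=N^{-(k_1+\dots+k_r)}\|f\|^K_{E_{k_1,\dots,k_r}}$; analogously for $(m_1,\dots,m_t)$ with $M=\prod m_j$. *)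

theory Defs
  imports Complex_Main "HOL-Library.FuncSet" "HOL-Library.Cardinality"
begin

(* A point x encodes (x_1,...,x_r), where x_i in G^(k_i) has j-th coordinate x i j. *)
definition E_points :: "nat \<Rightarrow> (nat \<Rightarrow> nat) \<Rightarrow> (nat \<Rightarrow> nat \<Rightarrow> 'a) set" where
  "E_points r k = (\<Pi>\<^sub>E i\<in>{1..r}. {1..k i} \<rightarrow>\<^sub>E UNIV)"

definition E_box :: "nat \<Rightarrow> (nat \<Rightarrow> nat) \<Rightarrow> (nat \<Rightarrow> nat) set" where
  "E_box r k = (\<Pi>\<^sub>E i\<in>{1..r}. {1..k i})"

definition E_sum ::
    "nat \<Rightarrow> (nat \<Rightarrow> nat) \<Rightarrow> ('a::{finite,ab_group_add} \<Rightarrow> real) \<Rightarrow> real" where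
  "E_sum r k f = (\<Sum>x\<in>E_points r k. \<Prod>\<omega>\<in>E_box r k. f (\<Sum>i=1..r. x i (\<omega> i)))"

(* On a negative argument, root of a positive index is negative; so nonnegativity of E_norm
   is equivalent to nonnegativity of E_sum and is not built into the definition. *)
definition E_norm ::
    "nat \<Rightarrow> (nat \<Rightarrow> nat) \<Rightarrow> ('a::{finite,ab_group_add} \<Rightarrow> real) \<Rightarrow> real" where
  "E_norm r k f = root (\<Prod>j=1..r. k j) (E_sum r k f)"

definition E_bar_norm ::
    "nat \<Rightarrow> (nat \<Rightarrow> nat) \<Rightarrow> ('a::{finite,ab_group_add} \<Rightarrow> real) \<Rightarrow> real" where
  "E_bar_norm r k f =
     root (\<Prod>j=1..r. k j) (E_sum r k f / real CARD('a) ^ (\<Sum>j=1..r. k j))"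

definition is_norm :: "(('a \<Rightarrow> real) \<Rightarrow> real) \<Rightarrow> bool" where
  "is_norm \<nu> \<longleftrightarrow>
     (\<forall>f. 0 \<le> \<nu> f) \<and>
     (\<forall>f. \<nu> f = 0 \<longleftrightarrow> f = (\<lambda>_. 0)) \<and>
     (\<forall>c f. \<nu> (\<lambda>x. c * f x) = \<bar>c\<bar> * \<nu> f) \<and>
     (\<forall>f g. \<nu> (\<lambda>x. f x + g x) \<le> \<nu> f + \<nu> g)"

end

theory Submission
  imports Defs "HOL-Analysis.Convex"
begin

text \<open>
  Give each vertex \<open>\<omega>\<close> of the box its own function \<open>F \<omega>\<close>. Summing over one block \<open>x_i\<close> first
  turns the resulting multilinear form into \<open>\<Sum>y. \<Prod>j\<le>k i. A_j y\<close>, so Hoelder's inequality with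
  the even exponent \<open>k i\<close> bounds it by forms that no longer depend on the coordinate \<open>\<omega> i\<close>.
  Iterating over all blocks gives a Gowers-Cauchy-Schwarz inequality, bounding the form by the
  product of the norms of the \<open>F \<omega>\<close>. The triangle inequality follows by expanding \<open>f + g\<close>
  multilinearly, and monotonicity by placing \<open>f\<close> on a sub-box of shape \<open>(k_1, ..., k_r, 1, ..., 1)\<close>
  of the larger box and \<open>1\<close> elsewhere. For definiteness, the terms of
  \<open>\<Sum>y. (A y) ^ k i\<close> are nonnegative, and the one at \<open>y = 0\<close> is a power of \<open>\<Sum>a. f a ^ n\<close>,
  where \<open>n\<close> is even because there are at least two blocks.
\<close>

section \<open>Hoelder's inequality for finite products of functions\<close>

text \<open>This is the arithmetic-geometric mean inequality for the numbers
  \<open>b j ^ card J\<close>, whose geometric mean is the product of the \<open>b j\<close>. It is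
  the pointwise estimate behind Hoelder's inequality.\<close>

lemma prod_le_mean_power:
  fixes b :: "'j \<Rightarrow> real"
  assumes "finite J" "J \<noteq> {}" "\<And>j. j \<in> J \<Longrightarrow> 0 \<le> b j"
  shows "(\<Prod>j\<in>J. b j) \<le> (\<Sum>j\<in>J. b j ^ card J) / real (card J)"
proof -
  have n: "card J > 0" using assms by (simp add: card_gt_0_iff)
  have nn: "0 \<le> (\<Prod>j\<in>J. b j)" using assms by (intro prod_nonneg) auto
  have "(\<Prod>j\<in>J. b j ^ card J) powr (1 / card J) \<le> (\<Sum>j\<in>J. b j ^ card J / card J)"
    using assms by (intro arith_geom_mean) auto
  moreover have "(\<Prod>j\<in>J. b j ^ card J) powr (1 / card J) = (\<Prod>j\<in>J. b j)"
  proof -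
    \<comment> \<open>Passing between \<open>powr\<close> and \<open>root\<close> needs a positive
      base, so a vanishing product is a separate case.\<close>
    have "(\<Prod>j\<in>J. b j ^ card J) powr (1 / card J) = root (card J) ((\<Prod>j\<in>J. b j) ^ card J)"
      using n nn by (cases "(\<Prod>j\<in>J. b j) = 0")
        (auto simp: prod_power_distrib[symmetric] root_powr_inverse power_0_left)
    also have "\<dots> = (\<Prod>j\<in>J. b j)"
      using n nn by (rule real_root_power_cancel)
    finally show ?thesis .
  qed
  ultimately show ?thesis by (simp add: sum_divide_distrib)
qed

text \<open>Each factor is divided by its own norm \<open>R j\<close> and the pointwise mean
  inequality is summed over \<open>Y\<close>. If some norm is zero, that factor vanishes on all of
  \<open>Y\<close> and so does the left-hand side.\<close>

lemma Holder_sum_prod: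
  fixes a :: "'j \<Rightarrow> 'y \<Rightarrow> real"
  assumes "finite J" "J \<noteq> {}" "finite Y"
  shows "\<bar>\<Sum>y\<in>Y. \<Prod>j\<in>J. a j y\<bar> ^ card J \<le> (\<Prod>j\<in>J. \<Sum>y\<in>Y. \<bar>a j y\<bar> ^ card J)"
proof -
  define n where "n = card J"
  have n: "n > 0" using assms by (simp add: card_gt_0_iff n_def)
  define S where "S j = (\<Sum>y\<in>Y. \<bar>a j y\<bar> ^ n)" for j
  have S0: "0 \<le> S j" for j by (simp add: S_def sum_nonneg)
  show ?thesis
  proof (cases "\<exists>j\<in>J. S j = 0")
    case True
    then obtain j where j: "j \<in> J" "S j = 0" by blast
    then have "a j y = 0" if "y \<in> Y" for y
      using that assms n by (auto simp: S_def sum_nonneg_eq_0_iff)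
    then have "(\<Prod>j\<in>J. a j y) = 0" if "y \<in> Y" for y
      using that j assms by auto
    then have "(\<Sum>y\<in>Y. \<Prod>j\<in>J. a j y) = 0" by simp
    moreover have "0 \<le> (\<Prod>j\<in>J. S j)" using S0 by (simp add: prod_nonneg)
    ultimately show ?thesis using n by (simp add: S_def n_def power_0_left)
  next
    case False
    then have Spos: "0 < S j" if "j \<in> J" for j using S0[of j] that by force
    define R where "R j = root n (S j)" for j
    have R: "0 < R j" "R j ^ n = S j" if "j \<in> J" for j
      using Spos[OF that] n by (auto simp: R_def)
    have pR: "0 < (\<Prod>j\<in>J. R j)" using R by (simp add: prod_pos)
    have "\<bar>\<Sum>y\<in>Y. \<Prod>j\<in>J. a j y\<bar> \<le> (\<Sum>y\<in>Y. \<Prod>j\<in>J. \<bar>a j y\<bar>)"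
      by (rule order_trans[OF sum_abs]) (simp add: abs_prod)
    also have "\<dots> = (\<Prod>j\<in>J. R j) * (\<Sum>y\<in>Y. \<Prod>j\<in>J. \<bar>a j y\<bar> / R j)"
      using pR by (simp add: prod_dividef sum_divide_distrib[symmetric])
    also have "(\<Sum>y\<in>Y. \<Prod>j\<in>J. \<bar>a j y\<bar> / R j) \<le> (\<Sum>y\<in>Y. (\<Sum>j\<in>J. (\<bar>a j y\<bar> / R j) ^ n) / n)"
      unfolding n_def using assms R
      by (intro sum_mono prod_le_mean_power) (auto intro!: divide_nonneg_nonneg simp: less_imp_le)
    also have "\<dots> = (\<Sum>j\<in>J. \<Sum>y\<in>Y. (\<bar>a j y\<bar> / R j) ^ n) / n"
      by (subst sum.swap) (simp add: sum_divide_distrib)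
    \<comment> \<open>Every normalised factor has norm 1, so the mean over \<open>J\<close> is
      exactly 1.\<close>
    also have "(\<Sum>j\<in>J. \<Sum>y\<in>Y. (\<bar>a j y\<bar> / R j) ^ n) = (\<Sum>j\<in>J. 1)"
    proof (rule sum.cong)
      fix j assume j: "j \<in> J"
      have "(\<Sum>y\<in>Y. (\<bar>a j y\<bar> / R j) ^ n) = S j / R j ^ n"
        by (simp add: power_divide S_def sum_divide_distrib)
      then show "(\<Sum>y\<in>Y. (\<bar>a j y\<bar> / R j) ^ n) = 1" using R[OF j] Spos[OF j] by simp
    qed simp
    finally have le: "\<bar>\<Sum>y\<in>Y. \<Prod>j\<in>J. a j y\<bar> \<le> (\<Prod>j\<in>J. R j)"
      using pR n by (simp add: n_def)
    have "\<bar>\<Sum>y\<in>Y. \<Prod>j\<in>J. a j y\<bar> ^ n \<le> (\<Prod>j\<in>J. R j) ^ n"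
      using le by (intro power_mono) auto
    also have "\<dots> = (\<Prod>j\<in>J. S j)"
      using R by (simp add: prod_power_distrib)
    finally show ?thesis by (simp add: S_def n_def)
  qed
qed

section \<open>Sums and products over dependent function spaces\<close>

lemma sum_PiE_insert:
  assumes "i \<notin> I"
  shows "(\<Sum>x\<in>PiE (insert i I) A. g x) = (\<Sum>y\<in>PiE I A. \<Sum>z\<in>A i. g (y(i := z)))"
proof -
  have "(\<Sum>x\<in>PiE (insert i I) A. g x) = (\<Sum>(z, y)\<in>A i \<times> PiE I A. g (y(i := z)))"
    unfolding PiE_insert_eq using inj_combinator[OF assms, of A]
    by (subst sum.reindex) (auto simp: case_prod_unfold)
  also have "\<dots> = (\<Sum>z\<in>A i. \<Sum>y\<in>PiE I A. g (y(i := z)))"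
    by (rule sum.cartesian_product[symmetric])
  also have "\<dots> = (\<Sum>y\<in>PiE I A. \<Sum>z\<in>A i. g (y(i := z)))"
    by (rule sum.swap)
  finally show ?thesis .
qed

lemma prod_PiE_insert:
  assumes "i \<notin> I"
  shows "(\<Prod>x\<in>PiE (insert i I) A. g x) = (\<Prod>y\<in>PiE I A. \<Prod>z\<in>A i. g (y(i := z)))"
proof -
  have "(\<Prod>x\<in>PiE (insert i I) A. g x) = (\<Prod>(z, y)\<in>A i \<times> PiE I A. g (y(i := z)))"
    unfolding PiE_insert_eq using inj_combinator[OF assms, of A]
    by (subst prod.reindex) (auto simp: case_prod_unfold)
  also have "\<dots> = (\<Prod>z\<in>A i. \<Prod>y\<in>PiE I A. g (y(i := z)))"
    by (rule prod.cartesian_product[symmetric])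
  also have "\<dots> = (\<Prod>y\<in>PiE I A. \<Prod>z\<in>A i. g (y(i := z)))"
    by (rule prod.swap)
  finally show ?thesis .
qed

text \<open>A fibre of the coordinatewise map is itself a product of the fibres of the maps
  \<open>p i\<close>, hence has \<open>\<Prod>i\<in>I. c i\<close> points. This will serve to sum
  out the entries on which a summand does not depend.\<close>

lemma sum_PiE_fibres:
  fixes g :: "('i \<Rightarrow> 'b) \<Rightarrow> real"
  assumes I: "finite I" and fin: "\<And>i. i \<in> I \<Longrightarrow> finite (A i)" "\<And>i. i \<in> I \<Longrightarrow> finite (B i)"
    and p: "\<And>i a. i \<in> I \<Longrightarrow> a \<in> A i \<Longrightarrow> p i a \<in> B i"
    and c: "\<And>i b. i \<in> I \<Longrightarrow> b \<in> B i \<Longrightarrow> card {a \<in> A i. p i a = b} = c i"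
  shows "(\<Sum>x\<in>PiE I A. g (\<lambda>i\<in>I. p i (x i))) = real (\<Prod>i\<in>I. c i) * (\<Sum>y\<in>PiE I B. g y)"
proof -
  let ?r = "\<lambda>x. \<lambda>i\<in>I. p i (x i)"
  have "(\<Sum>x\<in>PiE I A. g (?r x)) = (\<Sum>y\<in>PiE I B. \<Sum>x\<in>{x \<in> PiE I A. ?r x = y}. g (?r x))"
  proof (rule sum.group[symmetric])
    show "?r ` PiE I A \<subseteq> PiE I B"
      using p by (auto simp: PiE_iff)
  qed (use I fin in \<open>auto intro: finite_PiE\<close>)
  also have "\<dots> = (\<Sum>y\<in>PiE I B. real (\<Prod>i\<in>I. c i) * g y)"
  proof (rule sum.cong)
    fix y assume y: "y \<in> PiE I B"
    have "{x \<in> PiE I A. ?r x = y} = PiE I (\<lambda>i. {a \<in> A i. p i a = y i})"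
    proof (intro set_eqI iffI)
      fix x assume "x \<in> PiE I (\<lambda>i. {a \<in> A i. p i a = y i})"
      then show "x \<in> {x \<in> PiE I A. ?r x = y}"
        using y by (auto simp: PiE_iff extensional_def fun_eq_iff)
    qed (auto simp: PiE_iff)
    then have "card {x \<in> PiE I A. ?r x = y} = (\<Prod>i\<in>I. c i)"
      using I y c by (simp add: card_PiE PiE_mem)
    then show "(\<Sum>x\<in>{x \<in> PiE I A. ?r x = y}. g (?r x)) = real (\<Prod>i\<in>I. c i) * g y"
      by simp
  qed simp
  finally show ?thesis by (simp add: sum_distrib_left)
qed

section \<open>The multilinear form and its slices along one block\<close>

text \<open>A separate function at each vertex makes the form multilinear. An arbitrary index set
  \<open>I\<close>, in place of an initial segment, allows any block to be split off.\<close>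

definition E_form ::
  "'i set \<Rightarrow> ('i \<Rightarrow> nat) \<Rightarrow> (('i \<Rightarrow> nat) \<Rightarrow> 'a::{finite,ab_group_add} \<Rightarrow> real) \<Rightarrow> real" where
  "E_form I k F = (\<Sum>x\<in>(\<Pi>\<^sub>E i\<in>I. {1..k i} \<rightarrow>\<^sub>E UNIV).
     \<Prod>\<omega>\<in>(\<Pi>\<^sub>E i\<in>I. {1..k i}). F \<omega> (\<Sum>i\<in>I. x i (\<omega> i)))"

lemma E_sum_eq_E_form: "E_sum r k f = E_form {1..r} k (\<lambda>_. f)"
  by (simp add: E_sum_def E_form_def E_points_def E_box_def)

lemma E_form_cong:
  assumes "\<And>\<omega> a. \<omega> \<in> (\<Pi>\<^sub>E i\<in>I. {1..k i}) \<Longrightarrow> F \<omega> a = G \<omega> a"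
  shows "E_form I k F = E_form I k G"
  unfolding E_form_def using assms by (intro sum.cong prod.cong) auto

text \<open>Once the other blocks \<open>y\<close> are fixed, the vertices with \<open>i\<close>-th
  coordinate \<open>j\<close> see only the \<open>j\<close>-th entry of block \<open>i\<close>. The
  entries are therefore independent, and the sum over block \<open>i\<close> factorises over
  \<open>j\<close>.\<close>

lemma E_form_insert:
  assumes "finite I" "i \<notin> I"
  shows "E_form (insert i I) k F = (\<Sum>y\<in>(\<Pi>\<^sub>E i\<in>I. {1..k i} \<rightarrow>\<^sub>E UNIV). \<Prod>j\<in>{1..k i}.
    \<Sum>a\<in>UNIV. \<Prod>\<eta>\<in>(\<Pi>\<^sub>E i\<in>I. {1..k i}). F (\<eta>(i := j)) (a + (\<Sum>i'\<in>I. y i' (\<eta> i'))))"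
proof -
  have *: "(\<Sum>i'\<in>insert i I. (y(i := z)) i' ((\<eta>(i := j)) i')) = z j + (\<Sum>i'\<in>I. y i' (\<eta> i'))"
    for y :: "'a \<Rightarrow> nat \<Rightarrow> 'b" and z \<eta> j
  proof -
    have "(\<Sum>i'\<in>I. (y(i := z)) i' ((\<eta>(i := j)) i')) = (\<Sum>i'\<in>I. y i' (\<eta> i'))"
      using assms by (intro sum.cong) auto
    then show ?thesis using assms by simp
  qed
  show ?thesis
    unfolding E_form_def sum_PiE_insert[OF assms(2)] prod_PiE_insert[OF assms(2)] *
    by (subst prod.swap) (simp add: prod_sum_PiE)
qed

text \<open>The \<open>k i\<close> factors of \<open>E_form_insert\<close> coincide here; the
  resulting powers are the source of nonnegativity when \<open>k i\<close> is even.\<close>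

lemma E_form_insert_const:
  assumes "finite I" "i \<notin> I" "\<And>\<eta> j. F (\<eta>(i := j)) = F \<eta>"
  shows "E_form (insert i I) k F = (\<Sum>y\<in>(\<Pi>\<^sub>E i\<in>I. {1..k i} \<rightarrow>\<^sub>E UNIV).
    (\<Sum>a\<in>UNIV. \<Prod>\<eta>\<in>(\<Pi>\<^sub>E i\<in>I. {1..k i}). F \<eta> (a + (\<Sum>i'\<in>I. y i' (\<eta> i')))) ^ k i)"
  using assms by (simp add: E_form_insert)

section \<open>The Gowers-Cauchy-Schwarz inequality\<close>

text \<open>Hoelder's inequality is applied to the \<open>k i\<close> slices \<open>A j\<close>.
  Evenness of \<open>k i\<close> identifies each sum of \<open>\<bar>A j y\<bar> ^ k i\<close> with
  the form whose \<open>i\<close>-th coordinate is frozen at \<open>j\<close>.\<close>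

lemma E_form_Cauchy_Schwarz_coordinate:
  fixes F :: "('i \<Rightarrow> nat) \<Rightarrow> 'a::{finite,ab_group_add} \<Rightarrow> real"
  assumes "finite I" "i \<in> I" "even (k i)" "k i > 0"
  shows "\<bar>E_form I k F\<bar> ^ k i \<le> (\<Prod>j\<in>{1..k i}. \<bar>E_form I k (\<lambda>\<omega>. F (\<omega>(i := j)))\<bar>)"
proof -
  define L where "L = I - {i}"
  have L: "finite L" "i \<notin> L" "I = insert i L" using assms by (auto simp: L_def)
  define Y where "Y = (\<Pi>\<^sub>E i\<in>L. {1..k i} \<rightarrow>\<^sub>E (UNIV :: 'a set))"
  have Y: "finite Y" unfolding Y_def using L by (intro finite_PiE) auto
  define A where "A j y = (\<Sum>a\<in>UNIV. \<Prod>\<eta>\<in>(\<Pi>\<^sub>E i\<in>L. {1..k i}).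
      F (\<eta>(i := j)) (a + (\<Sum>i'\<in>L. y i' (\<eta> i'))))" for j and y :: "'i \<Rightarrow> nat \<Rightarrow> 'a"
  have eq: "E_form I k (\<lambda>\<omega>. F (\<omega>(i := j))) = (\<Sum>y\<in>Y. \<bar>A j y\<bar> ^ k i)" for j
    using assms L(1,2) unfolding L(3) Y_def A_def
    by (subst E_form_insert_const) (auto simp: power_even_abs)
  have "\<bar>E_form I k F\<bar> ^ k i = \<bar>\<Sum>y\<in>Y. \<Prod>j\<in>{1..k i}. A j y\<bar> ^ card {1..k i}"
    using L(1,2) unfolding L(3) Y_def A_def by (subst E_form_insert) auto
  also have "\<dots> \<le> (\<Prod>j\<in>{1..k i}. \<Sum>y\<in>Y. \<bar>A j y\<bar> ^ card {1..k i})"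
    using assms Y by (intro Holder_sum_prod) auto
  also have "\<dots> = (\<Prod>j\<in>{1..k i}. \<bar>E_form I k (\<lambda>\<omega>. F (\<omega>(i := j)))\<bar>)"
    unfolding eq by (intro prod.cong) (auto simp: abs_of_nonneg sum_nonneg)
  finally show ?thesis .
qed

text \<open>Induction on the set \<open>J\<close> of frozen coordinates: each further block raises
  the inequality to the power \<open>k s\<close> and splits every form on the right into
  \<open>k s\<close> forms.\<close>

lemma E_form_Cauchy_Schwarz_partial:
  fixes F :: "('i \<Rightarrow> nat) \<Rightarrow> 'a::{finite,ab_group_add} \<Rightarrow> real"
  assumes I: "finite I" and k: "\<And>i. i \<in> I \<Longrightarrow> even (k i) \<and> k i > 0"
    and J: "finite J" "J \<subseteq> I"
  shows "\<bar>E_form I k F\<bar> ^ (\<Prod>i\<in>J. k i) \<le>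
    (\<Prod>\<eta>\<in>(\<Pi>\<^sub>E i\<in>J. {1..k i}). \<bar>E_form I k (\<lambda>\<omega>. F (\<lambda>i. if i \<in> J then \<eta> i else \<omega> i))\<bar>)"
  using J
proof (induction J rule: finite_induct)
  case empty
  then show ?case by simp
next
  case (insert s J)
  have s: "s \<in> I" "s \<notin> J" using insert by auto
  let ?G = "\<lambda>\<eta> \<omega>. F (\<lambda>i. if i \<in> J then \<eta> i else \<omega> i)"
  have "\<bar>E_form I k F\<bar> ^ (\<Prod>i\<in>insert s J. k i) = (\<bar>E_form I k F\<bar> ^ (\<Prod>i\<in>J. k i)) ^ k s"
    using insert by (simp add: power_mult[symmetric] mult.commute)
  also have "\<dots> \<le> (\<Prod>\<eta>\<in>(\<Pi>\<^sub>E i\<in>J. {1..k i}). \<bar>E_form I k (?G \<eta>)\<bar>) ^ k s"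
    using insert by (intro power_mono) auto
  also have "\<dots> = (\<Prod>\<eta>\<in>(\<Pi>\<^sub>E i\<in>J. {1..k i}). \<bar>E_form I k (?G \<eta>)\<bar> ^ k s)"
    by (simp add: prod_power_distrib)
  also have "\<dots> \<le> (\<Prod>\<eta>\<in>(\<Pi>\<^sub>E i\<in>J. {1..k i}).
      \<Prod>j\<in>{1..k s}. \<bar>E_form I k (\<lambda>\<omega>. ?G \<eta> (\<omega>(s := j)))\<bar>)"
    using E_form_Cauchy_Schwarz_coordinate[OF I s(1)] k[OF s(1)]
    by (intro prod_mono) auto
  also have "\<dots> = (\<Prod>\<eta>\<in>(\<Pi>\<^sub>E i\<in>insert s J. {1..k i}).
      \<bar>E_form I k (\<lambda>\<omega>. F (\<lambda>i. if i \<in> insert s J then \<eta> i else \<omega> i))\<bar>)"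
  \<comment> \<open>Freezing \<open>s\<close> at \<open>j\<close> on top of \<open>\<eta>\<close> is
    the same as freezing at \<open>\<eta>(s := j)\<close>, so the nested products merge into one
    over the larger box.\<close>
  proof -
    have "(\<lambda>i. if i \<in> J then \<eta> i else (\<omega>(s := j)) i) =
        (\<lambda>i. if i \<in> insert s J then (\<eta>(s := j)) i else \<omega> i)" for \<eta> \<omega> :: "'i \<Rightarrow> nat" and j
      using s by (auto simp: fun_eq_iff)
    then show ?thesis by (simp only: prod_PiE_insert[OF s(2)])
  qed
  finally show ?case .
qed

text \<open>Splitting off the even block \<open>i\<close> exhibits the form as a sum of even
  powers.\<close>

lemma E_form_const_nonneg:
  assumes "finite I" "i \<in> I" "even (k i)"
  shows "0 \<le> E_form I k (\<lambda>_. f)"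
proof -
  obtain L where L: "I = insert i L" "i \<notin> L" using assms by (meson mk_disjoint_insert)
  show ?thesis
    using assms L by (auto simp: E_form_insert_const intro!: sum_nonneg zero_le_even_power)
qed

text \<open>Freezing every coordinate leaves forms that carry the single function
  \<open>F \<eta>\<close> at all vertices.\<close>

lemma E_form_Cauchy_Schwarz:
  fixes F :: "('i \<Rightarrow> nat) \<Rightarrow> 'a::{finite,ab_group_add} \<Rightarrow> real"
  assumes I: "finite I" "I \<noteq> {}" and k: "\<And>i. i \<in> I \<Longrightarrow> even (k i) \<and> k i > 0"
  shows "\<bar>E_form I k F\<bar> \<le>
    (\<Prod>\<eta>\<in>(\<Pi>\<^sub>E i\<in>I. {1..k i}). root (\<Prod>i\<in>I. k i) (E_form I k (\<lambda>_. F \<eta>)))"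
proof -
  let ?K = "\<Prod>i\<in>I. k i"
  obtain i where i: "i \<in> I" using I by auto
  have K: "?K > 0" using k by (simp add: prod_pos)
  have nn: "0 \<le> E_form I k (\<lambda>_. f)" for f :: "'a \<Rightarrow> real"
    using E_form_const_nonneg[OF I(1) i] k[OF i] by blast
  have "\<bar>E_form I k F\<bar> ^ ?K \<le>
    (\<Prod>\<eta>\<in>(\<Pi>\<^sub>E i\<in>I. {1..k i}). \<bar>E_form I k (\<lambda>\<omega>. F (\<lambda>i. if i \<in> I then \<eta> i else \<omega> i))\<bar>)"
    by (rule E_form_Cauchy_Schwarz_partial[OF I(1) k I(1)]) auto
  also have "\<dots> = (\<Prod>\<eta>\<in>(\<Pi>\<^sub>E i\<in>I. {1..k i}). E_form I k (\<lambda>_. F \<eta>))"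
  proof (rule prod.cong)
    fix \<eta> assume \<eta>: "\<eta> \<in> (\<Pi>\<^sub>E i\<in>I. {1..k i})"
    have "E_form I k (\<lambda>\<omega>. F (\<lambda>i. if i \<in> I then \<eta> i else \<omega> i)) = E_form I k (\<lambda>_. F \<eta>)"
    proof (rule E_form_cong)
      fix \<omega> a assume "\<omega> \<in> (\<Pi>\<^sub>E i\<in>I. {1..k i})"
      \<comment> \<open>Outside \<open>I\<close> both points take the default value
        \<open>undefined\<close>, so the mixed point is \<open>\<eta>\<close> itself.\<close>
      with \<eta> have "(\<lambda>i. if i \<in> I then \<eta> i else \<omega> i) = \<eta>"
        by (auto simp: PiE_iff extensional_def fun_eq_iff)
      then show "F (\<lambda>i. if i \<in> I then \<eta> i else \<omega> i) a = F \<eta> a" by simp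
    qed
    then show "\<bar>E_form I k (\<lambda>\<omega>. F (\<lambda>i. if i \<in> I then \<eta> i else \<omega> i))\<bar> = E_form I k (\<lambda>_. F \<eta>)"
      using nn by simp
  qed simp
  also have "\<dots> = (\<Prod>\<eta>\<in>(\<Pi>\<^sub>E i\<in>I. {1..k i}). root ?K (E_form I k (\<lambda>_. F \<eta>))) ^ ?K"
    using K nn by (simp add: prod_power_distrib)
  finally have le: "\<bar>E_form I k F\<bar> ^ ?K \<le>
    (\<Prod>\<eta>\<in>(\<Pi>\<^sub>E i\<in>I. {1..k i}). root ?K (E_form I k (\<lambda>_. F \<eta>))) ^ ?K" .
  show ?thesis
    by (rule power_mono_iff[THEN iffD1, OF _ _ K le]) (simp_all add: prod_nonneg nn K)
qed

section \<open>Definiteness and algebra of the form\<close>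

text \<open>Two blocks are essential: with a single block the form is
  \<open>(\<Sum>a\<in>UNIV. f a) ^ k i\<close>, which detects only the total of \<open>f\<close>.
  The second block \<open>j\<close> makes the exponent \<open>?n\<close> even.\<close>

lemma E_form_eq_0_imp:
  fixes I :: "'i set" and f :: "'a::{finite,ab_group_add} \<Rightarrow> real"
  assumes "finite I" "i \<in> I" "j \<in> I" "i \<noteq> j" "\<And>i. i \<in> I \<Longrightarrow> even (k i) \<and> k i > 0"
    and "E_form I k (\<lambda>_. f) = 0"
  shows "f a = 0"
proof -
  define L where "L = I - {i}"
  have L: "finite L" "i \<notin> L" "I = insert i L" "j \<in> L" using assms(1-4) by (auto simp: L_def)
  define Y where "Y = (\<Pi>\<^sub>E i\<in>L. {1..k i} \<rightarrow>\<^sub>E (UNIV :: 'a set))"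
  have Y: "finite Y" unfolding Y_def using L by (intro finite_PiE) auto
  define A where "A y = (\<Sum>a\<in>UNIV. \<Prod>\<eta>\<in>(\<Pi>\<^sub>E i\<in>L. {1..k i}).
      f (a + (\<Sum>i'\<in>L. y i' (\<eta> i'))))" for y :: "'i \<Rightarrow> nat \<Rightarrow> 'a"
  have "(\<Sum>y\<in>Y. A y ^ k i) = 0"
    using assms(6) L(1,2) unfolding L(3) Y_def A_def by (simp add: E_form_insert_const)
  moreover have "0 \<le> A y ^ k i" for y using assms(2,5) by (simp add: zero_le_even_power)
  ultimately have A0: "A y = 0" if "y \<in> Y" for y
    using that Y by (simp add: sum_nonneg_eq_0_iff)
  \<comment> \<open>At the zero configuration all vertices of the remaining box evaluate
    \<open>f\<close> at the same point \<open>a\<close>. The restrictions make \<open>y0\<close>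
    extensional, hence a member of \<open>Y\<close>.\<close>
  define y0 where "y0 = (\<lambda>i\<in>L. \<lambda>j\<in>{1..k i}. 0 :: 'a)"
  let ?n = "card (\<Pi>\<^sub>E i\<in>L. {1..k i})"
  have n: "even ?n"
    using L(1,4) assms(3,5) by (auto simp: card_PiE even_prod_iff)
  have "A y0 = (\<Sum>a\<in>UNIV. \<Prod>\<eta>\<in>(\<Pi>\<^sub>E i\<in>L. {1..k i}). f a)"
    unfolding A_def
  proof (intro sum.cong prod.cong refl)
    fix a \<eta> assume "\<eta> \<in> (\<Pi>\<^sub>E i\<in>L. {1..k i})"
    then have "(\<Sum>i'\<in>L. y0 i' (\<eta> i')) = 0"
      by (intro sum.neutral) (auto simp: y0_def PiE_iff)
    then show "f (a + (\<Sum>i'\<in>L. y0 i' (\<eta> i'))) = f a" by simp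
  qed
  also have "\<dots> = (\<Sum>a\<in>UNIV. f a ^ ?n)" by simp
  finally have "(\<Sum>a\<in>UNIV. f a ^ ?n) = 0"
    using A0[of y0] by (auto simp: y0_def Y_def)
  then have "f a ^ ?n = 0"
    using n by (subst (asm) sum_nonneg_eq_0_iff) (auto simp: zero_le_even_power)
  then show ?thesis by simp
qed

lemma E_form_mult:
  assumes "finite I"
  shows "E_form I k (\<lambda>\<omega> a. c * F \<omega> a) = c ^ (\<Prod>i\<in>I. k i) * E_form I k F"
  using assms by (simp add: E_form_def prod.distrib card_PiE sum_distrib_left)

text \<open>Expanding the product over the vertices, \<open>X\<close> records where the summand
  \<open>F\<close> is chosen.\<close>

lemma E_form_add:
  assumes "finite I"
  shows "E_form I k (\<lambda>\<omega> a. F \<omega> a + G \<omega> a) =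
    (\<Sum>X\<in>Pow (\<Pi>\<^sub>E i\<in>I. {1..k i}). E_form I k (\<lambda>\<omega>. if \<omega> \<in> X then F \<omega> else G \<omega>))"
proof -
  let ?B = "\<Pi>\<^sub>E i\<in>I. {1..k i}"
  have B: "finite ?B" using assms by (intro finite_PiE) auto
  have split: "(\<Prod>\<omega>\<in>X. F \<omega> (s \<omega>)) * (\<Prod>\<omega>\<in>?B - X. G \<omega> (s \<omega>)) =
      (\<Prod>\<omega>\<in>?B. (if \<omega> \<in> X then F \<omega> else G \<omega>) (s \<omega>))" if "X \<in> Pow ?B" for X s
  proof -
    have "(\<Prod>\<omega>\<in>?B. (if \<omega> \<in> X then F \<omega> else G \<omega>) (s \<omega>)) =
      (\<Prod>\<omega>\<in>?B. if \<omega> \<in> X then F \<omega> (s \<omega>) else G \<omega> (s \<omega>))"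
      by (intro prod.cong) auto
    also have "\<dots> = (\<Prod>\<omega>\<in>X. F \<omega> (s \<omega>)) * (\<Prod>\<omega>\<in>?B - X. G \<omega> (s \<omega>))"
      using B that by (subst prod.If_cases) (auto simp: Int_absorb1 Diff_eq)
    finally show ?thesis by simp
  qed
  show ?thesis
    unfolding E_form_def
    by (subst sum.swap) (simp only: prod_add[OF B] split cong: sum.cong)
qed

lemma E_form_one:
  assumes "finite I"
  shows "E_form I k (\<lambda>_ _ :: 'a::{finite,ab_group_add}. 1) = real CARD('a) ^ (\<Sum>i\<in>I. k i)"
  using assms by (simp add: E_form_def card_PiE power_sum)

section \<open>Changing the shape of the box\<close>

text \<open>Vertices outside the small box contribute the factor 1, so the entries
  \<open>x i j\<close> with \<open>j > k i\<close> never occur. Each of them ranges freely over the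
  group and contributes a factor \<open>CARD('a)\<close>.\<close>

lemma E_form_restrict_box:
  fixes f :: "'a::{finite,ab_group_add} \<Rightarrow> real"
  assumes I: "finite I" and km: "\<And>i. i \<in> I \<Longrightarrow> k i \<le> m i"
  shows "E_form I m (\<lambda>\<omega>. if \<omega> \<in> (\<Pi>\<^sub>E i\<in>I. {1..k i}) then f else (\<lambda>_. 1)) =
    real CARD('a) ^ (\<Sum>i\<in>I. m i - k i) * E_form I k (\<lambda>_. f)"
proof -
  let ?B = "\<Pi>\<^sub>E i\<in>I. {1..k i}" and ?B' = "\<Pi>\<^sub>E i\<in>I. {1..m i}"
  let ?p = "\<lambda>i z. restrict z {1..k i} :: nat \<Rightarrow> 'a"
  define g where "g y = (\<Prod>\<omega>\<in>?B. f (\<Sum>i\<in>I. y i (\<omega> i)))" for y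
  have BB: "?B \<subseteq> ?B'" using km by (intro PiE_mono) auto
  have B': "finite ?B'" using I by (intro finite_PiE) auto
  have "(\<Prod>\<omega>\<in>?B'. (if \<omega> \<in> ?B then f else (\<lambda>_. 1)) (\<Sum>i\<in>I. x i (\<omega> i))) =
      g (\<lambda>i\<in>I. ?p i (x i))" for x
  proof -
    have "(\<Prod>\<omega>\<in>?B'. (if \<omega> \<in> ?B then f else (\<lambda>_. 1)) (\<Sum>i\<in>I. x i (\<omega> i))) =
        (\<Prod>\<omega>\<in>?B. f (\<Sum>i\<in>I. x i (\<omega> i)))"
      using BB B' by (intro prod.mono_neutral_cong_right) auto
    also have "\<dots> = g (\<lambda>i\<in>I. ?p i (x i))"
      unfolding g_def
    proof (intro prod.cong refl)
      fix \<omega> assume "\<omega> \<in> ?B"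
      then have "(\<Sum>i\<in>I. x i (\<omega> i)) = (\<Sum>i\<in>I. (\<lambda>i\<in>I. ?p i (x i)) i (\<omega> i))"
        by (intro sum.cong) (auto simp: PiE_iff)
      then show "f (\<Sum>i\<in>I. x i (\<omega> i)) = f (\<Sum>i\<in>I. (\<lambda>i\<in>I. ?p i (x i)) i (\<omega> i))" by simp
    qed
    finally show ?thesis .
  qed
  then have "E_form I m (\<lambda>\<omega>. if \<omega> \<in> ?B then f else (\<lambda>_. 1)) =
      (\<Sum>x\<in>(\<Pi>\<^sub>E i\<in>I. {1..m i} \<rightarrow>\<^sub>E UNIV). g (\<lambda>i\<in>I. ?p i (x i)))"
    by (simp add: E_form_def)
  also have "\<dots> = real (\<Prod>i\<in>I. CARD('a) ^ (m i - k i)) *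
      (\<Sum>y\<in>(\<Pi>\<^sub>E i\<in>I. {1..k i} \<rightarrow>\<^sub>E UNIV). g y)"
  proof (rule sum_PiE_fibres)
    fix i and b :: "nat \<Rightarrow> 'a" assume i: "i \<in> I" and b: "b \<in> {1..k i} \<rightarrow>\<^sub>E UNIV"
    \<comment> \<open>In a fibre the first \<open>k i\<close> entries are prescribed and the other
      \<open>m i - k i\<close> are free.\<close>
    have "{a \<in> {1..m i} \<rightarrow>\<^sub>E UNIV. ?p i a = b} =
        (\<Pi>\<^sub>E j\<in>{1..m i}. if j \<le> k i then {b j} else UNIV)"
    proof (intro set_eqI iffI)
      fix x assume "x \<in> {a \<in> {1..m i} \<rightarrow>\<^sub>E UNIV. ?p i a = b}"
      then show "x \<in> (\<Pi>\<^sub>E j\<in>{1..m i}. if j \<le> k i then {b j} else UNIV)"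
        by (auto simp: PiE_iff)
    next
      fix x assume x: "x \<in> (\<Pi>\<^sub>E j\<in>{1..m i}. if j \<le> k i then {b j} else UNIV)"
      have "?p i x j = b j" for j
        using x b km[OF i] by (cases "j \<in> {1..k i}") (auto simp: PiE_iff extensional_def split: if_splits)
      then show "x \<in> {a \<in> {1..m i} \<rightarrow>\<^sub>E UNIV. ?p i a = b}"
        using x by (auto simp: PiE_iff)
    qed
    then have "card {a \<in> {1..m i} \<rightarrow>\<^sub>E UNIV. ?p i a = b} =
        (\<Prod>j\<in>{1..m i}. if j \<le> k i then 1 else CARD('a))"
      by (simp add: card_PiE if_distrib cong: if_cong)
    also have "\<dots> = (\<Prod>j\<in>{k i<..m i}. CARD('a))"
      by (intro prod.mono_neutral_cong_right) auto
    finally show "card {a \<in> {1..m i} \<rightarrow>\<^sub>E UNIV. ?p i a = b} = CARD('a) ^ (m i - k i)" by simp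
  qed (use I in \<open>auto intro!: finite_PiE\<close>)
  also have "real (\<Prod>i\<in>I. CARD('a) ^ (m i - k i)) = real CARD('a) ^ (\<Sum>i\<in>I. m i - k i)"
    by (simp add: power_sum)
  finally show ?thesis by (simp add: E_form_def g_def)
qed

text \<open>The translation is absorbed by the variable \<open>a\<close> of one block, which is
  summed over the whole group; a nonempty \<open>I\<close> supplies that block.\<close>

lemma E_form_shift:
  fixes F :: "('i \<Rightarrow> nat) \<Rightarrow> 'a::{finite,ab_group_add} \<Rightarrow> real"
  assumes "finite I" "I \<noteq> {}"
  shows "E_form I k (\<lambda>\<omega> a. F \<omega> (b + a)) = E_form I k F"
proof -
  obtain i L where L: "I = insert i L" "i \<notin> L" using assms by (metis ex_in_conv mk_disjoint_insert)
  have fL: "finite L" using assms L by simp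
  have sh: "(\<Sum>a\<in>UNIV. h (b + a)) = (\<Sum>a\<in>UNIV. h a)" for h :: "'a \<Rightarrow> real"
    by (rule sum.reindex_bij_betw[of "(+) b"]) simp
  have "(\<Sum>a\<in>UNIV. \<Prod>\<eta>\<in>P. F (\<eta>(i := j)) (b + (a + s \<eta>))) =
     (\<Sum>a\<in>UNIV. \<Prod>\<eta>\<in>P. F (\<eta>(i := j)) (a + s \<eta>))" for P s j
    using sh[of "\<lambda>a. \<Prod>\<eta>\<in>P. F (\<eta>(i := j)) (a + s \<eta>)"] by (simp add: add.assoc)
  then show ?thesis using L fL by (simp add: E_form_insert)
qed

text \<open>A block of length 1 is a single variable that translates all arguments at once, so by
  \<open>E_form_shift\<close> each of its values yields the same form.\<close>

lemma E_form_insert_singleton: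
  fixes f :: "'a::{finite,ab_group_add} \<Rightarrow> real"
  assumes "finite I" "I \<noteq> {}" "i \<notin> I" "k i = 1"
  shows "E_form (insert i I) k (\<lambda>_. f) = real CARD('a) * E_form I k (\<lambda>_. f)"
proof -
  have "E_form (insert i I) k (\<lambda>_. f) = (\<Sum>a\<in>UNIV. E_form I k (\<lambda>_ x. f (a + x)))"
    using assms unfolding E_form_def[of I]
    by (subst sum.swap) (simp add: E_form_insert_const)
  also have "\<dots> = (\<Sum>a\<in>(UNIV :: 'a set). E_form I k (\<lambda>_. f))"
    using E_form_shift[OF assms(1,2), of k "\<lambda>_. f"] by simp
  finally show ?thesis by simp
qed

text \<open>Padding by blocks of length 1 only rescales the form, so shapes with different numbers
  of blocks can be compared over one index set.\<close>

lemma E_form_extend_by_singletons: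
  fixes f :: "'a::{finite,ab_group_add} \<Rightarrow> real"
  assumes "finite I" "I \<noteq> {}" "finite J" "I \<inter> J = {}" "\<And>i. i \<in> J \<Longrightarrow> k i = 1"
  shows "E_form (I \<union> J) k (\<lambda>_. f) = real CARD('a) ^ card J * E_form I k (\<lambda>_. f)"
  using assms(3-5)
proof (induction J rule: finite_induct)
  case (insert j J)
  then show ?case
    using assms(1,2) by (simp add: E_form_insert_singleton)
qed simp

lemma E_form_index_cong:
  assumes "\<And>i. i \<in> I \<Longrightarrow> k i = k' i"
  shows "E_form I k F = E_form I k' F"
proof -
  have "(\<Pi>\<^sub>E i\<in>I. {1..k i} \<rightarrow>\<^sub>E UNIV) = (\<Pi>\<^sub>E i\<in>I. {1..k' i} \<rightarrow>\<^sub>E (UNIV :: 'b set))"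
    "(\<Pi>\<^sub>E i\<in>I. {1..k i}) = (\<Pi>\<^sub>E i\<in>I. {1..k' i})"
    using assms by (auto intro!: PiE_cong)
  then show ?thesis by (simp add: E_form_def)
qed

section \<open>The norm axioms\<close>

lemma root_E_form_triangle:
  fixes f g :: "'a::{finite,ab_group_add} \<Rightarrow> real"
  assumes I: "finite I" "I \<noteq> {}" and k: "\<And>i. i \<in> I \<Longrightarrow> even (k i) \<and> k i > 0"
  defines "\<nu> \<equiv> \<lambda>h :: 'a \<Rightarrow> real. root (\<Prod>i\<in>I. k i) (E_form I k (\<lambda>_. h))"
  shows "\<nu> (\<lambda>x. f x + g x) \<le> \<nu> f + \<nu> g"
proof -
  let ?K = "\<Prod>i\<in>I. k i" and ?B = "\<Pi>\<^sub>E i\<in>I. {1..k i}"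
  have B: "finite ?B" "card ?B = ?K" using I by (auto intro!: finite_PiE simp: card_PiE)
  have K: "?K > 0" using k by (simp add: prod_pos)
  obtain i where i: "i \<in> I" using I by auto
  have nn: "0 \<le> E_form I k (\<lambda>_. h)" for h :: "'a \<Rightarrow> real"
    using E_form_const_nonneg[OF I(1) i] k[OF i] by blast
  have \<nu>0: "0 \<le> \<nu> h" for h using nn K by (simp add: \<nu>_def)
  have "\<nu> (\<lambda>x. f x + g x) ^ ?K = E_form I k (\<lambda>_ x. f x + g x)"
    using nn K by (simp add: \<nu>_def)
  also have "\<dots> = (\<Sum>X\<in>Pow ?B. E_form I k (\<lambda>\<omega>. if \<omega> \<in> X then f else g))"
    using E_form_add[OF I(1), of k "\<lambda>_. f" "\<lambda>_. g"] by simp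
  also have "\<dots> \<le> (\<Sum>X\<in>Pow ?B. (\<Prod>\<eta>\<in>X. \<nu> f) * (\<Prod>\<eta>\<in>?B - X. \<nu> g))"
  proof (rule sum_mono)
    fix X assume X: "X \<in> Pow ?B"
    have "E_form I k (\<lambda>\<omega>. if \<omega> \<in> X then f else g) \<le>
      (\<Prod>\<eta>\<in>?B. \<nu> (if \<eta> \<in> X then f else g))"
      unfolding \<nu>_def by (rule order_trans[OF abs_ge_self E_form_Cauchy_Schwarz[OF I k]])
    also have "\<dots> = (\<Prod>\<eta>\<in>?B. if \<eta> \<in> X then \<nu> f else \<nu> g)"
      by (intro prod.cong) auto
    also have "\<dots> = (\<Prod>\<eta>\<in>X. \<nu> f) * (\<Prod>\<eta>\<in>?B - X. \<nu> g)"
      using B X by (subst prod.If_cases) (auto simp: Int_absorb1 Diff_eq)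
    finally show "E_form I k (\<lambda>\<omega>. if \<omega> \<in> X then f else g) \<le>
      (\<Prod>\<eta>\<in>X. \<nu> f) * (\<Prod>\<eta>\<in>?B - X. \<nu> g)" .
  qed
  \<comment> \<open>The expansion over subsets is read backwards, now with constant factors at the
    \<open>?K\<close> vertices.\<close>
  also have "\<dots> = (\<nu> f + \<nu> g) ^ ?K"
    using prod_add[OF B(1), of "\<lambda>_. \<nu> f" "\<lambda>_. \<nu> g"] B(2) by simp
  finally have le: "\<nu> (\<lambda>x. f x + g x) ^ ?K \<le> (\<nu> f + \<nu> g) ^ ?K" .
  show ?thesis
    by (rule power_mono_iff[THEN iffD1, OF _ _ K le]) (simp_all add: \<nu>0)
qed

lemma is_norm_root_E_form:
  assumes I: "finite I" "i \<in> I" "j \<in> I" "i \<noteq> j" and k: "\<And>i. i \<in> I \<Longrightarrow> even (k i) \<and> k i > 0"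
  shows "is_norm (\<lambda>h :: 'a::{finite,ab_group_add} \<Rightarrow> real.
    root (\<Prod>i\<in>I. k i) (E_form I k (\<lambda>_. h)))"
proof -
  let ?K = "\<Prod>i\<in>I. k i"
  have K: "?K > 0" using k by (simp add: prod_pos)
  have Keven: "even ?K" using I k by (auto simp: even_prod_iff)
  have zero: "E_form I k (\<lambda>_ _ :: 'a. 0) = 0"
    using E_form_mult[OF I(1), of k 0 "\<lambda>_ _. 0"] K by (simp add: power_0_left)
  have "root ?K (E_form I k (\<lambda>_ x. c * f x)) = \<bar>c\<bar> * root ?K (E_form I k (\<lambda>_. f))"
    for c and f :: "'a \<Rightarrow> real"
  proof -
    \<comment> \<open>Since \<open>?K\<close> is even, \<open>c ^ ?K\<close> equals
      \<open>\<bar>c\<bar> ^ ?K\<close>, whose root is \<open>\<bar>c\<bar>\<close> for either sign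
      of \<open>c\<close>.\<close>
    have "root ?K (E_form I k (\<lambda>_ x. c * f x)) = root ?K (\<bar>c\<bar> ^ ?K) * root ?K (E_form I k (\<lambda>_. f))"
      using E_form_mult[OF I(1), of k c "\<lambda>_. f"] Keven by (simp add: real_root_mult power_even_abs)
    then show ?thesis using real_root_power_cancel[OF K, of "\<bar>c\<bar>"] by simp
  qed
  moreover have "0 \<le> root ?K (E_form I k (\<lambda>_. f))" for f :: "'a \<Rightarrow> real"
    using E_form_const_nonneg[OF I(1,2), of k f] k[OF I(2)] K by simp
  moreover have "root ?K (E_form I k (\<lambda>_. f)) = 0 \<longleftrightarrow> f = (\<lambda>_. 0)" for f :: "'a \<Rightarrow> real"
    using E_form_eq_0_imp[OF I k, where f = f] zero K by auto
  moreover have "root ?K (E_form I k (\<lambda>_ x. f x + g x)) \<le>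
      root ?K (E_form I k (\<lambda>_. f)) + root ?K (E_form I k (\<lambda>_. g))" for f g :: "'a \<Rightarrow> real"
    using I k by (intro root_E_form_triangle) auto
  ultimately show ?thesis
    unfolding is_norm_def by blast
qed

section \<open>Monotonicity of the normalised norms\<close>

text \<open>In the Gowers-Cauchy-Schwarz bound for \<open>?F\<close>, the \<open>?K\<close> vertices
  of the sub-box carry the norm of \<open>f\<close> and the other \<open>?M - ?K\<close> that of the
  constant 1, which normalisation turns into 1.\<close>

lemma E_form_bar_mono:
  fixes f :: "'a::{finite,ab_group_add} \<Rightarrow> real"
  assumes T: "finite T" "I \<subseteq> T" "I \<noteq> {}"
    and k: "\<And>i. i \<in> I \<Longrightarrow> 0 < k i \<and> k i \<le> m i"
    and m: "\<And>i. i \<in> T \<Longrightarrow> even (m i) \<and> m i > 0"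
  shows "root (\<Prod>i\<in>I. k i) (E_form I k (\<lambda>_. f) / real CARD('a) ^ (\<Sum>i\<in>I. k i))
    \<le> root (\<Prod>i\<in>T. m i) (E_form T m (\<lambda>_. f) / real CARD('a) ^ (\<Sum>i\<in>T. m i))"
    (is "root ?K _ \<le> root ?M _")
proof -
  let ?N = "real CARD('a)"
  \<comment> \<open>The padded shape has the same index set as \<open>m\<close>, while its box still
    has \<open>?K\<close> vertices.\<close>
  define k' where "k' i = (if i \<in> I then k i else 1)" for i
  let ?B = "\<Pi>\<^sub>E i\<in>T. {1..k' i}" and ?B' = "\<Pi>\<^sub>E i\<in>T. {1..m i}"
  let ?F = "\<lambda>\<omega>. if \<omega> \<in> ?B then f else (\<lambda>_. 1)"
  have I: "finite I" using T finite_subset by auto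
  have k'm: "k' i \<le> m i" if "i \<in> T" for i
    using that k m[OF that] by (auto simp: k'_def)
  have K: "?K > 0" using k by (simp add: prod_pos)
  have M: "?M > 0" using m by (simp add: prod_pos)
  obtain i where i: "i \<in> T" using T by auto
  have nn: "0 \<le> E_form T m (\<lambda>_. f)"
    using E_form_const_nonneg[OF T(1) i] m[OF i] by blast
  have sum_k': "(\<Sum>i\<in>T. k' i) = (\<Sum>i\<in>I. k i) + card (T - I)"
    using T I by (simp add: k'_def sum.If_cases Int_absorb1 Diff_eq)
  have prod_k': "(\<Prod>i\<in>T. k' i) = ?K"
    using T I by (simp add: k'_def prod.If_cases Int_absorb1)
  have "E_form T k' (\<lambda>_. f) = E_form (I \<union> (T - I)) k' (\<lambda>_. f)"
    using T by (simp add: Un_absorb1)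
  also have "\<dots> = ?N ^ card (T - I) * E_form I k' (\<lambda>_. f)"
    using T I by (intro E_form_extend_by_singletons) (auto simp: k'_def)
  also have "E_form I k' (\<lambda>_. f) = E_form I k (\<lambda>_. f)"
    by (intro E_form_index_cong) (auto simp: k'_def)
  finally have "E_form T m ?F = ?N ^ (\<Sum>i\<in>T. m i - k' i) * (?N ^ card (T - I) * E_form I k (\<lambda>_. f))"
    using E_form_restrict_box[OF T(1), of k' m f] k'm by simp
  moreover have "(\<Sum>i\<in>T. m i) = (\<Sum>i\<in>T. m i - k' i) + card (T - I) + (\<Sum>i\<in>I. k i)"
  proof -
    have "(\<Sum>i\<in>T. m i) = (\<Sum>i\<in>T. (m i - k' i) + k' i)" using k'm by (intro sum.cong) auto
    then show ?thesis by (simp only: sum.distrib sum_k')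
  qed
  \<comment> \<open>The free entries and the padding blocks account exactly for the difference of
    the two normalising exponents.\<close>
  ultimately have eq: "E_form T m ?F / ?N ^ (\<Sum>i\<in>T. m i) = E_form I k (\<lambda>_. f) / ?N ^ (\<Sum>i\<in>I. k i)"
    by (simp add: power_add)
  have BB: "?B \<subseteq> ?B'" using k'm by (intro PiE_mono) auto
  have B': "finite ?B'" "card ?B' = ?M" using T by (auto intro!: finite_PiE simp: card_PiE)
  have B: "card ?B = ?K" using T prod_k' by (simp add: card_PiE)
  \<comment> \<open>By \<open>E_form_one\<close>, this is the unnormalised norm of the constant
    1.\<close>
  define R where "R = root ?M (?N ^ (\<Sum>i\<in>T. m i))"
  have R: "R > 0" "R ^ ?M = ?N ^ (\<Sum>i\<in>T. m i)" using M by (auto simp: R_def)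
  have "E_form T m ?F \<le> (\<Prod>\<eta>\<in>?B'. root ?M (E_form T m (\<lambda>_. ?F \<eta>)))"
    using T by (intro order_trans[OF abs_ge_self E_form_Cauchy_Schwarz] m) auto
  also have "\<dots> = (\<Prod>\<eta>\<in>?B'. if \<eta> \<in> ?B then root ?M (E_form T m (\<lambda>_. f)) else R)"
    using E_form_one[OF T(1), of m, where ?'a = 'a] by (intro prod.cong) (auto simp: R_def)
  also have "\<dots> = root ?M (E_form T m (\<lambda>_. f)) ^ ?K * R ^ (?M - ?K)"
    using B' B BB by (subst prod.If_cases)
      (auto simp: Int_absorb1 Diff_eq[symmetric] card_Diff_subset finite_subset)
  finally have "E_form T m ?F / ?N ^ (\<Sum>i\<in>T. m i) \<le>
      root ?M (E_form T m (\<lambda>_. f)) ^ ?K * R ^ (?M - ?K) / R ^ ?M"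
    unfolding R(2) by (intro divide_right_mono) auto
  \<comment> \<open>The factors from vertices carrying 1 cancel; one division by \<open>R\<close>
    remains for each vertex carrying \<open>f\<close> and normalises its norm.\<close>
  also have "R ^ ?M = R ^ (?M - ?K) * R ^ ?K"
    using card_mono[OF B'(1) BB] B' B by (simp add: power_add[symmetric])
  also have "root ?M (E_form T m (\<lambda>_. f)) ^ ?K * R ^ (?M - ?K) / (R ^ (?M - ?K) * R ^ ?K) =
      root ?M (E_form T m (\<lambda>_. f) / ?N ^ (\<Sum>i\<in>T. m i)) ^ ?K"
    using R(1) by (simp add: real_root_divide power_divide R_def[symmetric])
  finally have "E_form I k (\<lambda>_. f) / ?N ^ (\<Sum>i\<in>I. k i) \<le>
      root ?M (E_form T m (\<lambda>_. f) / ?N ^ (\<Sum>i\<in>T. m i)) ^ ?K"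
    unfolding eq .
  then have "root ?K (E_form I k (\<lambda>_. f) / ?N ^ (\<Sum>i\<in>I. k i)) \<le>
      root ?K (root ?M (E_form T m (\<lambda>_. f) / ?N ^ (\<Sum>i\<in>T. m i)) ^ ?K)"
    using K by (rule real_root_le_mono[rotated])
  also have "\<dots> = root ?M (E_form T m (\<lambda>_. f) / ?N ^ (\<Sum>i\<in>T. m i))"
    using K M nn by (intro real_root_power_cancel) auto
  finally show ?thesis .
qed

theorem theorem24:
  fixes r :: nat and k :: "nat \<Rightarrow> nat"
  assumes "r \<ge> 2"
    and "\<forall>j\<in>{1..r}. k j \<ge> 2 \<and> even (k j)"
  shows "is_norm (E_norm r k :: ('a::{finite,ab_group_add} \<Rightarrow> real) \<Rightarrow> real) \<and>
    (\<forall>(t::nat) (m :: nat \<Rightarrow> nat).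
       t \<ge> r \<longrightarrow>
       (\<forall>j\<in>{1..t}. m j \<ge> 2 \<and> even (m j)) \<longrightarrow>
       (\<forall>j\<in>{1..r}. k j \<le> m j) \<longrightarrow>
       (\<forall>f :: 'a \<Rightarrow> real. E_bar_norm r k f \<le> E_bar_norm t m f))"
proof (intro conjI allI impI)
  have norm_eq: "E_norm r k =
      (\<lambda>h :: 'a \<Rightarrow> real. root (\<Prod>i\<in>{1..r}. k i) (E_form {1..r} k (\<lambda>_. h)))"
    by (simp add: fun_eq_iff E_norm_def E_sum_eq_E_form)
  show "is_norm (E_norm r k :: ('a \<Rightarrow> real) \<Rightarrow> real)"
    unfolding norm_eq using assms
    \<comment> \<open>The bound \<open>r \<ge> 2\<close> provides the two distinct blocks 1 and
      2.\<close>
    by (intro is_norm_root_E_form[of _ 1 2]) force+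
next
  fix t :: nat and m :: "nat \<Rightarrow> nat" and f :: "'a \<Rightarrow> real"
  assume tm: "t \<ge> r" "\<forall>j\<in>{1..t}. m j \<ge> 2 \<and> even (m j)" "\<forall>j\<in>{1..r}. k j \<le> m j"
  show "E_bar_norm r k f \<le> E_bar_norm t m f"
    unfolding E_bar_norm_def E_sum_eq_E_form using assms tm
    by (intro E_form_bar_mono) force+
qed

end
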